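(* Let $F$ be a field and let $A=\bigoplus_{1\leqslant i\leqslant n,\,1\leqslant j\leqslant m} A_{ij}$ be a finite dimensional $S$-graded $F$-algebra, where $S=\mathcal{M}(\{e\}^0,n,m;P)$, such that $AJ(A)A=0$. Then there exist orthogonal idempotents $f_{1}, \ldots, f_m$ and orthogonal idempotents $f_1', \ldots, f_n'$ in $A$ (some of them could be zero) such that $$B=\bigoplus_{i,j} f_i' A f_j =\bigoplus_{i,j} (B\cap A_{ij})$$ is an $S$-graded maximal semisimple subalgebra of $A$, $f_i' \in B \cap R_i$ for $1\leqslant i \leqslant n$, $f_j \in B \cap L_j$ for $1\leqslant j \leqslant m$, $\sum_{i=1}^n f'_i=\sum_{j=1}^m f_j=1_B$, and $A=B\oplus J(A)$ (direct sum of subspaces).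
   Context: Algebras are associative, not necessarily unital; $J(A)$ is the Jacobson radical; products of subsets such as $AJ(A)A$ denote the additive span of the products of elements. $n,m$ are positive integers, $P=(p_{jk})$ is an $m\times n$ matrix with entries in $\{e,\theta\}$, and $S=\mathcal{M}(\{e\}^0,n,m;P)=\{(e,i,j)\mid 1\leqslant i\leqslant n,\ 1\leqslant j\leqslant m\}\cup\{\theta\}$ is the Rees matrix semigroup with zero $\theta$ and product $(e,i,j)(e,k,\ell)=(e,i,\ell)$ if $p_{jk}=e$ and $=\theta$ if $p_{jk}=\theta$. It is assumed that $S$ is completely $0$-simple (every row and every column of $P$ contains an entry $e$), that $S=\langle\operatorname{supp}(A)\rangle\cup\{\theta\}$ where $\operatorname{supp}(A)=\{s\in S\mid A^{(s)}\ne 0\}$ and $\langle\cdot\rangle$ is the generated subsemigroup, and that the homogeneous component of degree $\theta$ is zero. $A_{ij}$ denotes the homogeneous component of degree $(e,i,j)$; thus $A=\bigoplus_{i,j}A_{ij}$ (subspaces), $A_{ij}A_{k\ell}\subseteq A_{i\ell}$, and $A_{ij}A_{k\ell}=0$ if $p_{jk}=\theta$. Put $L_j=\bigoplus_{k=1}^n A_{kj}$ (a left ideal) and $R_i=\bigoplus_{k=1}^m A_{ik}$ (a right ideal). A subspace $V\subseteq A$ is $S$-graded if $V=\bigoplus_{i,j}(V\cap A_{ij})$. $1_B$ is the identity element of $B$. The zero algebra is allowed as $B$ (semisimple, with $1_B=0$). *)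

theory Defs
  imports Complex_Main "HOL-Library.FuncSet"
begin

(* The group with zero {e}^0, in which the sandwich matrix has its entries. *)
datatype triv0 = Unit_e | Zero_\<theta>

(* Elt i j is the triple (e,i,j). *)
datatype rees = Elt nat nat | Theta

definition rees_carrier :: "nat \<Rightarrow> nat \<Rightarrow> rees set" where
  "rees_carrier n m = {Elt i j | i j. i \<in> {1..n} \<and> j \<in> {1..m}} \<union> {Theta}"

fun rees_mult :: "(nat \<Rightarrow> nat \<Rightarrow> triv0) \<Rightarrow> rees \<Rightarrow> rees \<Rightarrow> rees" where
  "rees_mult P (Elt i j) (Elt k l) = (if P j k = Unit_e then Elt i l else Theta)"
| "rees_mult P Theta s = Theta"
| "rees_mult P (Elt i j) Theta = Theta"

(* For Rees matrix semigroups with zero, being completely 0-simple amounts to regularity of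
   the m x n sandwich matrix P: each row and each column has a nonzero entry. *)
definition rees_completely_0_simple :: "nat \<Rightarrow> nat \<Rightarrow> (nat \<Rightarrow> nat \<Rightarrow> triv0) \<Rightarrow> bool" where
  "rees_completely_0_simple n m P \<longleftrightarrow>
     (\<forall>j\<in>{1..m}. \<exists>k\<in>{1..n}. P j k = Unit_e) \<and> (\<forall>k\<in>{1..n}. \<exists>j\<in>{1..m}. P j k = Unit_e)"

inductive_set generated_subsemigroup :: "('s \<Rightarrow> 's \<Rightarrow> 's) \<Rightarrow> 's set \<Rightarrow> 's set"
  for mult :: "'s \<Rightarrow> 's \<Rightarrow> 's" and X :: "'s set" where
  base: "s \<in> X \<Longrightarrow> s \<in> generated_subsemigroup mult X"
| mult: "\<lbrakk>s \<in> generated_subsemigroup mult X; t \<in> generated_subsemigroup mult X\<rbrakk>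
    \<Longrightarrow> mult s t \<in> generated_subsemigroup mult X"

(* The class ring does not require an identity element. The algebra is the whole type 'a. *)
locale fd_algebra = finite_dimensional_vector_space scale Basis
  for scale :: "'f::field \<Rightarrow> 'a::ring \<Rightarrow> 'a" (infixr "*s" 75) and Basis :: "'a set" +
  assumes scale_mult_left: "(c *s x) * y = c *s (x * y)"
    and scale_mult_right: "x * (c *s y) = c *s (x * y)"

(* Additive span of the products of elements of X and Y. *)
definition set_mult :: "'a::ring set \<Rightarrow> 'a set \<Rightarrow> 'a set" where
  "set_mult X Y =
     {\<Sum>k<r. x k * y k | r x y. \<forall>k<(r::nat). x k \<in> X \<and> y k \<in> Y}"

(* W is the internal direct sum of the subspaces V i over the finite index set I:
   (v i) |-> sum of the v i is a bijection from the product of the V i onto W. *)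
definition is_direct_sum ::
    "('f::field \<Rightarrow> 'a::ring \<Rightarrow> 'a) \<Rightarrow> 'a set \<Rightarrow> 'i set \<Rightarrow> ('i \<Rightarrow> 'a set) \<Rightarrow> bool" where
  "is_direct_sum scale W I V \<longleftrightarrow>
     finite I \<and> (\<forall>i\<in>I. module.subspace scale (V i)) \<and>
     bij_betw (\<lambda>v. \<Sum>i\<in>I. v i) (PiE I V) W"

definition is_direct_sum2 ::
    "('f::field \<Rightarrow> 'a::ring \<Rightarrow> 'a) \<Rightarrow> 'a set \<Rightarrow> 'a set \<Rightarrow> 'a set \<Rightarrow> bool" where
  "is_direct_sum2 scale W U V \<longleftrightarrow>
     module.subspace scale U \<and> module.subspace scale V \<and>
     U \<inter> V = {0} \<and> W = {u + v | u v. u \<in> U \<and> v \<in> V}"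

definition subalgebra :: "('f::field \<Rightarrow> 'a::ring \<Rightarrow> 'a) \<Rightarrow> 'a set \<Rightarrow> bool" where
  "subalgebra scale B \<longleftrightarrow> module.subspace scale B \<and> (\<forall>x\<in>B. \<forall>y\<in>B. x * y \<in> B)"

definition left_ideal :: "('f::field \<Rightarrow> 'a::ring \<Rightarrow> 'a) \<Rightarrow> 'a set \<Rightarrow> 'a set \<Rightarrow> bool" where
  "left_ideal scale B M \<longleftrightarrow>
     M \<subseteq> B \<and> module.subspace scale M \<and> (\<forall>b\<in>B. \<forall>x\<in>M. b * x \<in> M)"

(* Modular (= regular) means that B has a right identity modulo M. *)
definition modular_maximal_left_ideal ::
    "('f::field \<Rightarrow> 'a::ring \<Rightarrow> 'a) \<Rightarrow> 'a set \<Rightarrow> 'a set \<Rightarrow> bool" where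
  "modular_maximal_left_ideal scale B M \<longleftrightarrow>
     left_ideal scale B M \<and> M \<noteq> B \<and>
     (\<forall>N. left_ideal scale B N \<and> M \<subseteq> N \<longrightarrow> N = M \<or> N = B) \<and>
     (\<exists>u\<in>B. \<forall>x\<in>B. x - x * u \<in> M)"

(* The Jacobson radical of a not necessarily unital algebra B is the intersection of its
   modular maximal left ideals, and is B itself if there are none. *)
definition jacobson_radical :: "('f::field \<Rightarrow> 'a::ring \<Rightarrow> 'a) \<Rightarrow> 'a set \<Rightarrow> 'a set" where
  "jacobson_radical scale B = {x \<in> B. \<forall>M. modular_maximal_left_ideal scale B M \<longrightarrow> x \<in> M}"

(* For subalgebras of finite dimensional algebras; the zero subalgebra is semisimple. *)
definition semisimple_subalgebra :: "('f::field \<Rightarrow> 'a::ring \<Rightarrow> 'a) \<Rightarrow> 'a set \<Rightarrow> bool" where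
  "semisimple_subalgebra scale B \<longleftrightarrow> subalgebra scale B \<and> jacobson_radical scale B = {0}"

(* Maximal among all semisimple subalgebras, graded or not. *)
definition maximal_semisimple_subalgebra ::
    "('f::field \<Rightarrow> 'a::ring \<Rightarrow> 'a) \<Rightarrow> 'a set \<Rightarrow> bool" where
  "maximal_semisimple_subalgebra scale B \<longleftrightarrow>
     semisimple_subalgebra scale B \<and>
     (\<forall>C. semisimple_subalgebra scale C \<and> B \<subseteq> C \<longrightarrow> C = B)"

definition is_identity_of :: "'a::ring set \<Rightarrow> 'a \<Rightarrow> bool" where
  "is_identity_of B u \<longleftrightarrow> u \<in> B \<and> (\<forall>b\<in>B. u * b = b \<and> b * u = b)"

definition orthogonal_idempotents :: "'i set \<Rightarrow> ('i \<Rightarrow> 'a::ring) \<Rightarrow> bool" where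
  "orthogonal_idempotents I f \<longleftrightarrow>
     (\<forall>i\<in>I. f i * f i = f i) \<and> (\<forall>i\<in>I. \<forall>k\<in>I. i \<noteq> k \<longrightarrow> f i * f k = 0)"

definition semigroup_grading ::
    "('f::field \<Rightarrow> 'a::ring \<Rightarrow> 'a) \<Rightarrow> 's set \<Rightarrow> ('s \<Rightarrow> 's \<Rightarrow> 's) \<Rightarrow> ('s \<Rightarrow> 'a set) \<Rightarrow> bool" where
  "semigroup_grading scale S mult G \<longleftrightarrow>
     is_direct_sum scale UNIV S G \<and>
     (\<forall>s\<in>S. \<forall>t\<in>S. \<forall>x\<in>G s. \<forall>y\<in>G t. x * y \<in> G (mult s t))"

definition grading_support :: "'s set \<Rightarrow> ('s \<Rightarrow> 'a::ring set) \<Rightarrow> 's set" where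
  "grading_support S G = {s \<in> S. G s \<noteq> {0}}"

definition A_comp :: "(rees \<Rightarrow> 'a set) \<Rightarrow> nat \<Rightarrow> nat \<Rightarrow> 'a set" where
  "A_comp G i j = G (Elt i j)"

(* L_j, a left ideal: the column index j is fixed. *)
definition L_comp :: "nat \<Rightarrow> (rees \<Rightarrow> 'a::ring set) \<Rightarrow> nat \<Rightarrow> 'a set" where
  "L_comp n G j = {\<Sum>k=1..n. a k | a. \<forall>k\<in>{1..n}. a k \<in> A_comp G k j}"

(* R_i, a right ideal: the row index i is fixed. *)
definition R_comp :: "nat \<Rightarrow> (rees \<Rightarrow> 'a::ring set) \<Rightarrow> nat \<Rightarrow> 'a set" where
  "R_comp m G i = {\<Sum>k=1..m. a k | a. \<forall>k\<in>{1..m}. a k \<in> A_comp G i k}"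

definition graded_subspace ::
    "('f::field \<Rightarrow> 'a::ring \<Rightarrow> 'a) \<Rightarrow> nat \<Rightarrow> nat \<Rightarrow> (rees \<Rightarrow> 'a set) \<Rightarrow> 'a set \<Rightarrow> bool" where
  "graded_subspace scale n m G V \<longleftrightarrow>
     is_direct_sum scale V ({1..n} \<times> {1..m}) (\<lambda>(i, j). V \<inter> A_comp G i j)"

end

theory Submission
  imports Defs
begin

text \<open>As \<open>A J A = 0\<close>, the radical is \<open>J = {x. A x A = 0}\<close>, which is left-right symmetric.
  Although \<open>J\<close> need not be graded, \<open>A / J\<close> is the sum of the images of the left ideals \<open>L j\<close>,
  and of the right ideals \<open>R i\<close>, so its identity is a sum of orthogonal idempotents represented by
  some \<open>g j \<in> L j\<close>, and also by some \<open>g' i \<in> R i\<close>. Put \<open>u = (\<Sum>j. g j * g j)\<close> and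
  \<open>u' = (\<Sum>i. g' i * g' i)\<close>. Since \<open>A J A = 0\<close>, the map \<open>x \<mapsto> u' x u\<close> depends only on \<open>x\<close>
  modulo \<open>J\<close>, and it is multiplicative because \<open>u u'\<close> represents the identity; its image \<open>B\<close> is the
  required complement of \<open>J\<close>. The images of \<open>g' i\<close> and \<open>g j\<close> lie in \<open>R i\<close> and \<open>L j\<close>, and \<open>B\<close> is graded
  because \<open>R i L j \<subseteq> A i j\<close>.\<close>

text \<open>The product is a parameter so that the opposite product gives the statements on right ideals.\<close>

locale semiprime_modulo = finite_dimensional_vector_space scale Basis
  for scale :: "'f::field \<Rightarrow> 'a::ab_group_add \<Rightarrow> 'a" (infixr "*s" 75) and Basis :: "'a set" +
  fixes mul :: "'a \<Rightarrow> 'a \<Rightarrow> 'a" (infixl "\<cdot>" 70) and N :: "'a set"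
  assumes mul_assoc: "(x \<cdot> y) \<cdot> z = x \<cdot> (y \<cdot> z)"
    and mul_add_left: "(x + y) \<cdot> z = x \<cdot> z + y \<cdot> z"
    and mul_add_right: "x \<cdot> (y + z) = x \<cdot> y + x \<cdot> z"
    and mul_scale_left: "(c *s x) \<cdot> y = c *s (x \<cdot> y)"
    and mul_scale_right: "x \<cdot> (c *s y) = c *s (x \<cdot> y)"
    and subspace_N: "subspace N"
    and N_mul_left: "x \<in> N \<Longrightarrow> a \<cdot> x \<in> N"
    and N_mul_right: "x \<in> N \<Longrightarrow> x \<cdot> a \<in> N"
    and semiprime:
      "\<lbrakk>subspace K; \<And>a x. x \<in> K \<Longrightarrow> a \<cdot> x \<in> K; \<And>x y. \<lbrakk>x \<in> K; y \<in> K\<rbrakk> \<Longrightarrow> x \<cdot> y \<in> N\<rbrakk> \<Longrightarrow> K \<subseteq> N"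
begin

definition is_lideal :: "'a set \<Rightarrow> bool" where
  "is_lideal K \<longleftrightarrow> subspace K \<and> (\<forall>a. \<forall>x\<in>K. a \<cdot> x \<in> K)"

definition eqv :: "'a \<Rightarrow> 'a \<Rightarrow> bool" (infix "\<approx>" 50) where
  "x \<approx> y \<longleftrightarrow> x - y \<in> N"

lemma mul_zero_left [simp]: "0 \<cdot> x = 0"
  using mul_add_left[of 0 0 x] by simp

lemma mul_zero_right [simp]: "x \<cdot> 0 = 0"
  using mul_add_right[of x 0 0] by simp

lemma mul_diff_left: "(x - y) \<cdot> z = x \<cdot> z - y \<cdot> z"
  using mul_add_left[of "x - y" y z] by (simp add: eq_diff_eq)

lemma mul_diff_right: "z \<cdot> (x - y) = z \<cdot> x - z \<cdot> y"
  using mul_add_right[of z "x - y" y] by (simp add: eq_diff_eq)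

lemma mul_sum_right: "x \<cdot> (\<Sum>i\<in>I. g i) = (\<Sum>i\<in>I. x \<cdot> g i)"
  by (induction I rule: infinite_finite_induct) (auto simp: mul_add_right)

lemmas mul_simps = mul_add_left mul_add_right mul_diff_left mul_diff_right mul_assoc

lemma eqv_refl [simp]: "x \<approx> x"
  by (simp add: eqv_def subspace_0[OF subspace_N])

lemma eqv_sym: "x \<approx> y \<Longrightarrow> y \<approx> x"
  using subspace_neg[OF subspace_N, of "x - y"] by (simp add: eqv_def)

lemma eqv_trans [trans]: "x \<approx> y \<Longrightarrow> y \<approx> z \<Longrightarrow> x \<approx> z"
  using subspace_add[OF subspace_N, of "x - y" "y - z"] by (simp add: eqv_def)

lemma eqv_add: "x \<approx> y \<Longrightarrow> x' \<approx> y' \<Longrightarrow> x + x' \<approx> y + y'"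
  using subspace_add[OF subspace_N, of "x - y" "x' - y'"] by (simp add: eqv_def algebra_simps)

lemma eqv_diff: "x \<approx> y \<Longrightarrow> x' \<approx> y' \<Longrightarrow> x - x' \<approx> y - y'"
  using subspace_diff[OF subspace_N, of "x - y" "x' - y'"] by (simp add: eqv_def algebra_simps)

lemma eqv_left: "x \<approx> y \<Longrightarrow> a \<cdot> x \<approx> a \<cdot> y"
  using N_mul_left[of "x - y" a] by (simp add: eqv_def mul_simps)

lemma eqv_right: "x \<approx> y \<Longrightarrow> x \<cdot> a \<approx> y \<cdot> a"
  using N_mul_right[of "x - y" a] by (simp add: eqv_def mul_simps)

lemma eqv_0_iff: "x \<approx> 0 \<longleftrightarrow> x \<in> N"
  by (simp add: eqv_def)

lemma eqv_mem: "x \<approx> y \<Longrightarrow> x \<in> N \<longleftrightarrow> y \<in> N"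
  using eqv_0_iff eqv_sym eqv_trans by blast

lemma is_lidealD:
  assumes "is_lideal K"
  shows "subspace K" "x \<in> K \<Longrightarrow> a \<cdot> x \<in> K" "0 \<in> K"
    "x \<in> K \<Longrightarrow> y \<in> K \<Longrightarrow> x + y \<in> K" "x \<in> K \<Longrightarrow> y \<in> K \<Longrightarrow> x - y \<in> K"
  using assms subspace_0 subspace_add subspace_diff by (auto simp: is_lideal_def)

lemma is_lideal_Int: "is_lideal K \<Longrightarrow> is_lideal L \<Longrightarrow> is_lideal (K \<inter> L)"
  by (simp add: is_lideal_def subspace_inter)

lemma is_lideal_right_image:
  assumes "is_lideal K"
  shows "is_lideal ((\<lambda>y. y \<cdot> x) ` K)"
proof -
  have "subspace ((\<lambda>y. y \<cdot> x) ` K)"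
  proof (rule subspaceI)
    show "0 \<in> (\<lambda>y. y \<cdot> x) ` K"
      by (rule image_eqI[of _ _ 0]) (simp_all add: is_lidealD[OF assms])
  next
    fix a b assume "a \<in> (\<lambda>y. y \<cdot> x) ` K" "b \<in> (\<lambda>y. y \<cdot> x) ` K"
    then show "a + b \<in> (\<lambda>y. y \<cdot> x) ` K"
      by (auto simp: mul_add_left[symmetric] intro!: imageI is_lidealD(4)[OF assms])
  next
    fix c a assume "a \<in> (\<lambda>y. y \<cdot> x) ` K"
    then show "c *s a \<in> (\<lambda>y. y \<cdot> x) ` K"
      using subspace_scale[OF is_lidealD(1)[OF assms]]
      by (auto simp: mul_scale_left[symmetric])
  qed
  then show ?thesis
    by (auto simp: is_lideal_def mul_assoc[symmetric] intro!: imageI is_lidealD(2)[OF assms])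
qed

lemma is_lideal_annihilator:
  assumes "is_lideal K"
  shows "is_lideal {y \<in> K. y \<cdot> x \<in> N}"
  unfolding is_lideal_def
  by (auto intro!: subspaceI simp: mul_add_left mul_scale_left mul_assoc N_mul_left
      is_lidealD[OF assms] subspace_0 subspace_add subspace_scale subspace_N is_lidealD(1)[OF assms])

lemma is_lideal_fixed: "is_lideal {x. x \<approx> x \<cdot> e}"
proof -
  have "subspace {x. x \<approx> x \<cdot> e}"
  proof (rule subspaceI)
    fix c x assume "x \<in> {x. x \<approx> x \<cdot> e}"
    then show "c *s x \<in> {x. x \<approx> x \<cdot> e}"
      using subspace_scale[OF subspace_N, of "x - x \<cdot> e" c]
      by (simp add: eqv_def mul_scale_left scale_right_diff_distrib)
  qed (auto simp: mul_add_left intro: eqv_add)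
  then show ?thesis
    by (auto simp: is_lideal_def mul_assoc intro: eqv_left)
qed

lemma is_lideal_complement:
  assumes "is_lideal K"
  shows "is_lideal ((\<lambda>x. x - x \<cdot> d) ` K)"
proof -
  have "subspace ((\<lambda>x. x - x \<cdot> d) ` K)"
  proof (rule subspaceI)
    show "0 \<in> (\<lambda>x. x - x \<cdot> d) ` K"
      by (rule image_eqI[of _ _ 0]) (simp_all add: is_lidealD[OF assms])
  next
    fix a b assume "a \<in> (\<lambda>x. x - x \<cdot> d) ` K" "b \<in> (\<lambda>x. x - x \<cdot> d) ` K"
    then obtain x y where "x \<in> K" "y \<in> K" "a = x - x \<cdot> d" "b = y - y \<cdot> d" by blast
    then show "a + b \<in> (\<lambda>x. x - x \<cdot> d) ` K"
      by (intro image_eqI[of _ _ "x + y"]) (auto simp: mul_add_left is_lidealD[OF assms])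
  next
    fix c a assume "a \<in> (\<lambda>x. x - x \<cdot> d) ` K"
    then obtain x where "x \<in> K" "a = x - x \<cdot> d" by blast
    then show "c *s a \<in> (\<lambda>x. x - x \<cdot> d) ` K"
      by (intro image_eqI[of _ _ "c *s x"])
        (auto simp: mul_scale_left scale_right_diff_distrib subspace_scale is_lidealD(1)[OF assms])
  qed
  moreover have "b \<cdot> a \<in> (\<lambda>x. x - x \<cdot> d) ` K" if a: "a \<in> (\<lambda>x. x - x \<cdot> d) ` K" for a b
  proof -
    obtain x where "x \<in> K" "a = x - x \<cdot> d" using a by blast
    then show ?thesis
      by (intro image_eqI[of _ _ "b \<cdot> x"]) (auto simp: mul_simps is_lidealD[OF assms])
  qed
  ultimately show ?thesis by (auto simp: is_lideal_def)
qed

lemma is_lideal_sum: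
  assumes "is_lideal K" "is_lideal L"
  shows "is_lideal {x + y | x y. x \<in> K \<and> y \<in> L}"
proof -
  have "a \<cdot> (x + y) \<in> {x + y | x y. x \<in> K \<and> y \<in> L}" if "x \<in> K" "y \<in> L" for a x y
    unfolding mul_add_right using that is_lidealD(2) assms by blast
  with subspace_sums[OF assms[THEN is_lidealD(1)]] show ?thesis
    by (auto simp: is_lideal_def)
qed

lemma dim_psubset:
  assumes "subspace K" "subspace L" "K \<subset> L"
  shows "dim K < dim L"
  using subspace_dim_equal[of K L] dim_subset[of K L] assms by (fastforce simp: not_le)

text \<open>Brauer's argument, applied to a left ideal of least dimension outside \<open>N\<close>.\<close>

lemma ex_idempotent_mod:
  assumes K: "is_lideal K" and nK: "\<not> K \<subseteq> N"
  shows "\<exists>c\<in>K. c \<notin> N \<and> c \<cdot> c \<approx> c"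
proof -
  obtain L where L: "is_lideal L" "L \<subseteq> K" "\<not> L \<subseteq> N"
    and min: "\<And>L'. \<lbrakk>is_lideal L'; L' \<subseteq> K; \<not> L' \<subseteq> N\<rbrakk> \<Longrightarrow> dim L \<le> dim L'"
    using ex_has_least_nat[of "\<lambda>L. is_lideal L \<and> L \<subseteq> K \<and> \<not> L \<subseteq> N" K dim] K nK by blast
  have minimal: "L' = L" if "is_lideal L'" "L' \<subseteq> L" "\<not> L' \<subseteq> N" for L'
    using that min[of L'] L dim_psubset[of L' L] by (force simp: is_lideal_def)
  obtain x z where x: "x \<in> L" "z \<in> L" "z \<cdot> x \<notin> N"
    using semiprime[of L] L by (auto simp: is_lideal_def)
  have "(\<lambda>y. y \<cdot> x) ` L = L"
    using x L by (intro minimal is_lideal_right_image) (auto simp: is_lideal_def)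
  then obtain e where e: "e \<in> L" "e \<cdot> x = x"
    using x(1) by (metis imageE)
  have xN: "x \<notin> N"
    using x(3) N_mul_left by blast
  have "e \<notin> {y \<in> L. y \<cdot> x \<in> N}"
    using e xN by simp
  then have "{y \<in> L. y \<cdot> x \<in> N} \<subseteq> N"
    using minimal[of "{y \<in> L. y \<cdot> x \<in> N}"] is_lideal_annihilator[OF L(1)] e(1) by blast
  moreover have "e \<cdot> e - e \<in> {y \<in> L. y \<cdot> x \<in> N}"
    using e is_lidealD[OF L(1)] by (simp add: mul_simps subspace_0[OF subspace_N])
  ultimately have "e \<cdot> e \<approx> e"
    by (auto simp: eqv_def)
  moreover have "e \<notin> N"
    using e(2) xN N_mul_right by metis
  ultimately show ?thesis
    using e(1) L(2) by blast
qed

lemma ex_right_identity_mod: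
  assumes L: "is_lideal L"
  shows "\<exists>d\<in>L. \<forall>x\<in>L. x \<approx> x \<cdot> d"
proof -
  let ?ann = "\<lambda>d. {x \<in> L. x \<cdot> d \<in> N}"
  have "\<exists>d\<in>L. \<forall>x\<in>L. x \<approx> x \<cdot> d" if "d \<in> L" "d \<cdot> d \<approx> d" for d
    using that
  proof (induction "dim (?ann d)" arbitrary: d rule: less_induct)
    case less
    show ?case
    proof (cases "?ann d \<subseteq> N")
      case True
      have "x \<approx> x \<cdot> d" if "x \<in> L" for x
      proof -
        have "(x - x \<cdot> d) \<cdot> d = x \<cdot> d - x \<cdot> (d \<cdot> d)" by (simp add: mul_simps)
        also have "\<dots> \<approx> x \<cdot> d - x \<cdot> d" by (intro eqv_diff eqv_left less.prems eqv_refl)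
        finally have "x - x \<cdot> d \<in> ?ann d"
          using that less.prems is_lidealD[OF L] by (simp add: eqv_0_iff)
        then show ?thesis using True by (auto simp: eqv_def)
      qed
      then show ?thesis using less.prems by blast
    next
      case False
      obtain c where c: "c \<in> L" "c \<cdot> d \<in> N" "c \<notin> N" "c \<cdot> c \<approx> c"
        using ex_idempotent_mod[OF is_lideal_annihilator[OF L] False] by blast
      define d' where "d' = d + c - d \<cdot> c"
      have "c \<cdot> d \<approx> 0" using c by (simp add: eqv_0_iff)
      have d'd: "d' \<cdot> d \<approx> d"
      proof -
        have "d' \<cdot> d = d \<cdot> d + c \<cdot> d - d \<cdot> (c \<cdot> d)" by (simp add: d'_def mul_simps)
        also have "\<dots> \<approx> d + 0 - d \<cdot> 0"
          by (intro eqv_diff eqv_add eqv_left less.prems \<open>c \<cdot> d \<approx> 0\<close>)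
        finally show ?thesis by simp
      qed
      have d'c: "d' \<cdot> c \<approx> c"
      proof -
        have "d' \<cdot> c = d \<cdot> c + c \<cdot> c - d \<cdot> (c \<cdot> c)" by (simp add: d'_def mul_simps)
        also have "\<dots> \<approx> d \<cdot> c + c - d \<cdot> c"
          by (intro eqv_diff eqv_add eqv_left c eqv_refl)
        finally show ?thesis by simp
      qed
      have "d' \<cdot> d' = d' \<cdot> d + d' \<cdot> c - d' \<cdot> d \<cdot> c" by (simp add: d'_def mul_simps)
      also have "\<dots> \<approx> d + c - d \<cdot> c" by (intro eqv_diff eqv_add eqv_right d'd d'c)
      finally have "d' \<cdot> d' \<approx> d'" by (simp add: d'_def)
      moreover have "d' \<in> L"
        using less.prems c is_lidealD[OF L] by (simp add: d'_def)
      moreover have "dim (?ann d') < dim (?ann d)"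
      proof (rule dim_psubset)
        have xd: "x \<cdot> d \<in> N" if "x \<cdot> d' \<in> N" for x
          using eqv_mem[OF eqv_left[OF d'd, of x]] N_mul_right[OF that, of d] by (simp add: mul_assoc)
        have xc: "x \<cdot> c \<in> N" if "x \<cdot> d' \<in> N" for x
          using eqv_mem[OF eqv_left[OF d'c, of x]] N_mul_right[OF that, of c] by (simp add: mul_assoc)
        have "c \<notin> ?ann d'"
          using xc[of c] c eqv_mem by blast
        with xd c show "?ann d' \<subset> ?ann d" by blast
      qed (use is_lidealD(1)[OF is_lideal_annihilator[OF L]] in auto)
      ultimately show ?thesis using less.hyps by blast
    qed
  qed
  from this[of 0] show ?thesis using is_lidealD(3)[OF L] by auto
qed

lemma ex_orthogonal_idempotents_mod:
  assumes "finite I" "\<And>j. j \<in> I \<Longrightarrow> is_lideal (L j)"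
  shows "\<exists>g. (\<forall>j\<in>I. g j \<in> L j) \<and> (\<forall>j\<in>I. \<forall>k\<in>I. g j \<cdot> g k \<approx> (if j = k then g j else 0)) \<and>
    (\<forall>j\<in>I. \<forall>x\<in>L j. x \<approx> x \<cdot> (\<Sum>k\<in>I. g k))"
  using assms
proof (induction I rule: finite_induct)
  case empty
  then show ?case by simp
next
  case (insert i I)
  then obtain g where g: "\<And>j. j \<in> I \<Longrightarrow> g j \<in> L j"
    and orth: "\<And>j k. j \<in> I \<Longrightarrow> k \<in> I \<Longrightarrow> g j \<cdot> g k \<approx> (if j = k then g j else 0)"
    and unit: "\<And>j x. j \<in> I \<Longrightarrow> x \<in> L j \<Longrightarrow> x \<approx> x \<cdot> (\<Sum>k\<in>I. g k)"
    by force
  define e where "e = (\<Sum>k\<in>I. g k)"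
  define E where "E = {x. x \<approx> x \<cdot> e}"
  have E: "is_lideal E" unfolding E_def by (rule is_lideal_fixed)
  have Li: "is_lideal (L i)" using insert.prems by blast
  have NE: "N \<subseteq> E"
    by (auto simp: E_def eqv_def N_mul_right subspace_diff[OF subspace_N])
  obtain d where d: "d \<in> L i" "d \<in> E" "\<And>x. x \<in> L i \<Longrightarrow> x \<in> E \<Longrightarrow> x \<approx> x \<cdot> d"
    using ex_right_identity_mod[OF is_lideal_Int[OF Li E]] by blast
  define M where "M = (\<lambda>x. x - x \<cdot> d) ` L i"
  have M: "is_lideal M" unfolding M_def by (rule is_lideal_complement[OF Li])
  have M_sub: "M \<subseteq> L i" using d(1) is_lidealD[OF Li] by (auto simp: M_def)
  have ME: "w \<in> N" if wM: "w \<in> M" and wE: "w \<in> E" for w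
  proof -
    obtain x where x: "x \<in> L i" "w = x - x \<cdot> d" using wM by (auto simp: M_def)
    have "w \<approx> w \<cdot> d" using d wM wE M_sub by blast
    also have "w \<cdot> d = x \<cdot> d - x \<cdot> d \<cdot> d" by (simp add: x(2) mul_simps)
    also have "\<dots> \<approx> x \<cdot> d \<cdot> d - x \<cdot> d \<cdot> d"
      by (intro eqv_diff eqv_refl d) (use d is_lidealD[OF Li] is_lidealD[OF E] in auto)
    finally show ?thesis by (simp add: eqv_0_iff)
  qed
  obtain y z where y: "y \<in> E" and z: "z \<in> M"
    and yz: "\<And>a b. a \<in> E \<Longrightarrow> b \<in> M \<Longrightarrow> a + b \<approx> (a + b) \<cdot> (y + z)"
    using ex_right_identity_mod[OF is_lideal_sum[OF E M]] by auto blast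
  have Ez: "a \<cdot> z \<in> N" and Ey: "a \<approx> a \<cdot> y" if a: "a \<in> E" for a
  proof -
    have 1: "a - (a \<cdot> y + a \<cdot> z) \<in> N"
      using yz[OF a is_lidealD(3)[OF M]] by (simp add: eqv_def mul_simps)
    have "a \<cdot> z = (a - a \<cdot> y) - (a - (a \<cdot> y + a \<cdot> z))" by simp
    also have "\<dots> \<in> E"
      by (intro is_lidealD[OF E] a y subsetD[OF NE 1])
    finally show 2: "a \<cdot> z \<in> N" using ME is_lidealD(2)[OF M z] by blast
    show "a \<approx> a \<cdot> y"
      using subspace_add[OF subspace_N 1 2] by (simp add: eqv_def)
  qed
  have zy: "z \<cdot> y \<in> N" and zz: "z \<cdot> z \<approx> z"
  proof -
    have 1: "z - (z \<cdot> y + z \<cdot> z) \<in> N"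
      using yz[OF is_lidealD(3)[OF E] z] by (simp add: eqv_def mul_simps)
    have "z - z \<cdot> z = (z - (z \<cdot> y + z \<cdot> z)) + z \<cdot> y" by simp
    also have "\<dots> \<in> E"
      by (intro is_lidealD[OF E] y subsetD[OF NE 1])
    finally have 2: "z - z \<cdot> z \<in> N" by (intro ME is_lidealD[OF M] z)
    then show "z \<cdot> z \<approx> z" using eqv_sym by (auto simp: eqv_def)
    show "z \<cdot> y \<in> N"
      using subspace_diff[OF subspace_N 2 1] by simp
  qed
  have gE: "g j \<in> E" if "j \<in> I" for j using unit g that by (auto simp: E_def e_def)
  define h where "h = (\<lambda>j. if j = i then z else y \<cdot> g j)"
  have hI: "h j = y \<cdot> g j" if "j \<in> I" for j using that insert.hyps by (auto simp: h_def)
  have hi: "h i = z" by (simp add: h_def)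
  have "(\<Sum>k\<in>insert i I. h k) = z + y \<cdot> e"
    using insert.hyps by (simp add: hi hI e_def mul_sum_right)
  then have sum_h: "y + z \<approx> (\<Sum>k\<in>insert i I. h k)"
    using y eqv_add[of y "y \<cdot> e" z z] by (simp add: E_def add.commute)
  show ?case
  proof (intro exI[of _ h] conjI ballI)
    fix j assume "j \<in> insert i I"
    then show "h j \<in> L j"
      using z M_sub g is_lidealD(2) insert.prems by (auto simp: hi hI)
  next
    fix j k assume jk: "j \<in> insert i I" "k \<in> insert i I"
    show "h j \<cdot> h k \<approx> (if j = k then h j else 0)"
    proof (cases "j = i"; cases "k = i")
      assume "j = i" "k = i"
      then show ?thesis using zz by (simp add: hi)
    next
      assume "j = i" "k \<noteq> i"
      then have "h j \<cdot> h k = (z \<cdot> y) \<cdot> g k" using jk by (simp add: hi hI mul_assoc)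
      then show ?thesis using zy N_mul_right \<open>j = i\<close> \<open>k \<noteq> i\<close> by (simp add: eqv_0_iff)
    next
      assume "j \<noteq> i" "k = i"
      then have "h j \<cdot> h k = y \<cdot> (g j \<cdot> z)" using jk by (simp add: hi hI mul_assoc)
      then show ?thesis using Ez[OF gE[of j]] N_mul_left jk \<open>j \<noteq> i\<close> \<open>k = i\<close> by (simp add: eqv_0_iff)
    next
      assume ne: "j \<noteq> i" "k \<noteq> i"
      then have I: "j \<in> I" "k \<in> I" using jk by auto
      have "h j \<cdot> h k = y \<cdot> (g j \<cdot> y) \<cdot> g k" using I by (simp add: hI mul_assoc)
      also have "\<dots> \<approx> y \<cdot> g j \<cdot> g k"
        by (intro eqv_right eqv_left eqv_sym[OF Ey] gE I)
      also have "y \<cdot> g j \<cdot> g k \<approx> y \<cdot> (if j = k then g j else 0)"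
        unfolding mul_assoc by (intro eqv_left orth I)
      finally show ?thesis using I by (simp add: hI split: if_splits)
    qed
  next
    fix j x assume j: "j \<in> insert i I" and x: "x \<in> L j"
    have "x \<approx> x \<cdot> (y + z)"
    proof (cases "j = i")
      case True
      then have "x \<cdot> d \<in> E" "x - x \<cdot> d \<in> M"
        using x d is_lidealD(2)[OF E] by (auto simp: M_def)
      from yz[OF this] show ?thesis by simp
    next
      case False
      then have "x \<in> E" using j x unit by (auto simp: E_def e_def)
      from yz[OF this is_lidealD(3)[OF M]] show ?thesis by simp
    qed
    also have "\<dots> \<approx> x \<cdot> (\<Sum>k\<in>insert i I. h k)"
      by (intro eqv_left sum_h)
    finally show "x \<approx> x \<cdot> (\<Sum>k\<in>insert i I. h k)" .
  qed
qed

end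

lemma is_direct_sum2E:
  assumes "is_direct_sum2 scale W U V" "x \<in> W"
  obtains y z where "x = y + z" "y \<in> U" "z \<in> V"
  using assms unfolding is_direct_sum2_def by blast

context fd_algebra
begin

lemma left_ideal_subset_modular_maximal:
  assumes C: "subalgebra scale C" and M: "modular_maximal_left_ideal scale C M"
    and K: "left_ideal scale C K" and nil: "\<And>x. x \<in> K \<Longrightarrow> x * x * x * x = 0"
  shows "K \<subseteq> M"
proof (rule ccontr)
  assume not_le: "\<not> K \<subseteq> M"
  have sub: "subspace C" "subspace M" "subspace K" and MC: "M \<subseteq> C" and KC: "K \<subseteq> C"
    and Cm: "\<And>x y. x \<in> C \<Longrightarrow> y \<in> C \<Longrightarrow> x * y \<in> C"
    and Mm: "\<And>x y. x \<in> C \<Longrightarrow> y \<in> M \<Longrightarrow> x * y \<in> M"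
    and Km: "\<And>x y. x \<in> C \<Longrightarrow> y \<in> K \<Longrightarrow> x * y \<in> K"
    and max: "\<And>T. left_ideal scale C T \<Longrightarrow> M \<subseteq> T \<Longrightarrow> T = M \<or> T = C"
    using C M K by (auto simp: subalgebra_def modular_maximal_left_ideal_def left_ideal_def)
  let ?T = "{x + y | x y. x \<in> M \<and> y \<in> K}"
  have "left_ideal scale C ?T"
    unfolding left_ideal_def
  proof (intro conjI ballI)
    show "?T \<subseteq> C" using MC KC subspace_add[OF sub(1)] by blast
    show "subspace ?T" by (intro subspace_sums sub)
    fix b z assume "b \<in> C" "z \<in> ?T"
    then show "b * z \<in> ?T" using Mm Km by (force simp: distrib_left)
  qed
  moreover have MT: "M \<subseteq> ?T" using subspace_0[OF sub(3)] by force
  moreover have "?T \<noteq> M"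
    using not_le subspace_0[OF sub(2)] by force
  ultimately have T: "?T = C"
    using max by blast
  obtain u where u: "u \<in> C" "\<And>x. x \<in> C \<Longrightarrow> x - x * u \<in> M"
    using M by (auto simp: modular_maximal_left_ideal_def)
  obtain v k where k: "u = v + k" "v \<in> M" "k \<in> K" using u(1) T by blast
  have step: "x - x * k \<in> M" if "x \<in> C" for x
    using subspace_add[OF sub(2) u(2)[OF that] Mm[OF that k(2)]] by (simp add: k(1) algebra_simps)
  have "x \<in> M" if x: "x \<in> C" for x
  proof -
    have kC: "k \<in> C" using k KC by auto
    have "(x - x * k) + (x * k - x * k * k) + (x * k * k - x * k * k * k)
        + (x * k * k * k - x * k * k * k * k) \<in> M"
      by (intro subspace_add[OF sub(2)] step Cm x kC)
    moreover have "x * k * k * k * k = 0"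
      using nil[OF k(3)] by (simp add: mult.assoc)
    ultimately show ?thesis by simp
  qed
  with MC have "M = C" by blast
  then show False using M by (auto simp: modular_maximal_left_ideal_def)
qed

lemma left_ideal_subset_jacobson_radical:
  assumes "subalgebra scale C" "left_ideal scale C K" "\<And>x. x \<in> K \<Longrightarrow> x * x * x * x = 0"
  shows "K \<subseteq> jacobson_radical scale C"
  using left_ideal_subset_modular_maximal[OF assms(1) _ assms(2,3)] assms(2)
  by (auto simp: jacobson_radical_def left_ideal_def)

lemma subalgebra_UNIV: "subalgebra scale UNIV"
  by (simp add: subalgebra_def)

lemma subspace_family_sum:
  assumes "\<And>k. k \<in> I \<Longrightarrow> subspace (V k)"
  shows "subspace {\<Sum>k\<in>I. a k | a. \<forall>k\<in>I. a k \<in> V k}" (is "subspace ?W")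
proof (rule subspaceI)
  show "0 \<in> ?W"
    using subspace_0[OF assms] by (force intro: exI[of _ "\<lambda>_. 0"])
next
  fix x y assume "x \<in> ?W" "y \<in> ?W"
  then obtain a b where "x = sum a I" "y = sum b I" "\<forall>k\<in>I. a k \<in> V k" "\<forall>k\<in>I. b k \<in> V k"
    by blast
  then show "x + y \<in> ?W"
    using subspace_add[OF assms]
    by (auto simp: sum.distrib[symmetric] intro!: exI[of _ "\<lambda>k. a k + b k"])
next
  fix c x assume "x \<in> ?W"
  then obtain a where "x = sum a I" "\<forall>k\<in>I. a k \<in> V k" by blast
  then show "c *s x \<in> ?W"
    using subspace_scale[OF assms]
    by (auto simp: scale_sum_right intro!: exI[of _ "\<lambda>k. c *s a k"])
qed

lemma family_sum_mem:
  assumes "finite I" "\<And>k. k \<in> I \<Longrightarrow> subspace (V k)" "i \<in> I" "x \<in> V i"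
  shows "x \<in> {\<Sum>k\<in>I. a k | a. \<forall>k\<in>I. a k \<in> V k}"
  using assms by (auto intro!: exI[of _ "\<lambda>k. if k = i then x else 0"] simp: subspace_0)

lemma is_direct_sum_peirce:
  assumes fin: "finite I" "finite K"
    and f: "orthogonal_idempotents K f" and f': "orthogonal_idempotents I f'"
    and B: "\<And>i j a. i \<in> I \<Longrightarrow> j \<in> K \<Longrightarrow> f' i * a * f j \<in> B" "subspace B"
    and unit: "\<And>b. b \<in> B \<Longrightarrow> (\<Sum>i\<in>I. f' i) * b * (\<Sum>j\<in>K. f j) = b"
  shows "is_direct_sum scale B (I \<times> K) (\<lambda>(i, j). {f' i * a * f j | a. a \<in> UNIV})"
proof -
  let ?V = "\<lambda>(i, j). {f' i * a * f j | a. a \<in> UNIV}"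
  have V: "subspace (?V p)" for p
  proof (cases p)
    case (Pair i j)
    have "subspace {f' i * a * f j | a. a \<in> UNIV}"
    proof (rule subspaceI)
      show "0 \<in> {f' i * a * f j | a. a \<in> UNIV}" by (force intro: exI[of _ 0])
    next
      fix x y assume "x \<in> {f' i * a * f j | a. a \<in> UNIV}" "y \<in> {f' i * a * f j | a. a \<in> UNIV}"
      then show "x + y \<in> {f' i * a * f j | a. a \<in> UNIV}"
        by (auto simp: distrib_left[symmetric] distrib_right[symmetric])
    next
      fix c x assume "x \<in> {f' i * a * f j | a. a \<in> UNIV}"
      then obtain a where "x = f' i * a * f j" by blast
      then have "c *s x = f' i * (c *s a) * f j"
        by (simp add: scale_mult_left scale_mult_right)
      then show "c *s x \<in> {f' i * a * f j | a. a \<in> UNIV}" by blast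
    qed
    then show ?thesis using Pair by simp
  qed
  have component: "f' i * (\<Sum>p\<in>I \<times> K. v p) * f j = v (i, j)"
    if v: "v \<in> PiE (I \<times> K) ?V" and ij: "i \<in> I" "j \<in> K" for v i j
  proof -
    have "f' i * v p * f j = (if p = (i, j) then v (i, j) else 0)" if p: "p \<in> I \<times> K" for p
    proof -
      obtain k l where kl: "p = (k, l)" "k \<in> I" "l \<in> K" using p by auto
      then obtain a where a: "v (k, l) = f' k * a * f l" using PiE_mem[OF v p] by auto
      have "f' i * v p * f j = (f' i * f' k) * a * (f l * f j)"
        by (simp add: kl a mult.assoc)
      also have "\<dots> = (if p = (i, j) then v (i, j) else 0)"
        using f f' ij kl a by (auto simp: orthogonal_idempotents_def)
      finally show ?thesis .
    qed
    then show ?thesis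
      using ij fin by (simp add: sum_distrib_left sum_distrib_right cong: sum.cong)
  qed
  have "inj_on (\<lambda>v. \<Sum>p\<in>I \<times> K. v p) (PiE (I \<times> K) ?V)"
  proof (rule inj_onI)
    fix v w assume vw: "v \<in> PiE (I \<times> K) ?V" "w \<in> PiE (I \<times> K) ?V"
      "(\<Sum>p\<in>I \<times> K. v p) = (\<Sum>p\<in>I \<times> K. w p)"
    have "v (i, j) = w (i, j)" if "i \<in> I" "j \<in> K" for i j
      using component[OF vw(1) that] component[OF vw(2) that] by (simp add: vw(3))
    then show "v = w" by (intro PiE_ext[OF vw(1,2)]) auto
  qed
  moreover have "(\<lambda>v. \<Sum>p\<in>I \<times> K. v p) ` PiE (I \<times> K) ?V = B"
  proof (intro equalityI subsetI)
    fix b assume "b \<in> (\<lambda>v. \<Sum>p\<in>I \<times> K. v p) ` PiE (I \<times> K) ?V"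
    then obtain v where "v \<in> PiE (I \<times> K) ?V" "b = (\<Sum>p\<in>I \<times> K. v p)" by blast
    moreover from this have "v p \<in> B" if "p \<in> I \<times> K" for p
      using PiE_mem[of v "I \<times> K" ?V p] that B(1) by auto
    ultimately show "b \<in> B" by (metis subspace_sum[OF B(2)])
  next
    fix b assume b: "b \<in> B"
    let ?v = "restrict (\<lambda>(i, j). f' i * b * f j) (I \<times> K)"
    have "b = (\<Sum>i\<in>I. \<Sum>j\<in>K. f' i * b * f j)"
      using unit[OF b, symmetric] by (simp only: sum_distrib_right[of _ _ b] sum_product)
    also have "\<dots> = (\<Sum>p\<in>I \<times> K. ?v p)"
      by (simp add: sum.cartesian_product)
    finally show "b \<in> (\<lambda>v. \<Sum>p\<in>I \<times> K. v p) ` PiE (I \<times> K) ?V"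
      by (intro image_eqI[of _ _ ?v]) auto
  qed
  ultimately show ?thesis
    using fin V by (auto simp: is_direct_sum_def bij_betw_def)
qed

lemma is_direct_sum_cong:
  assumes "\<And>i. i \<in> I \<Longrightarrow> V i = W i"
  shows "is_direct_sum scale B I V = is_direct_sum scale B I W"
  using PiE_cong[of I V W] assms by (simp add: is_direct_sum_def)

end

locale annihilated_radical = fd_algebra scale Basis
  for scale :: "'f::field \<Rightarrow> 'a::ring \<Rightarrow> 'a" (infixr "*s" 75) and Basis :: "'a set" +
  assumes annihilated: "set_mult (set_mult UNIV (jacobson_radical scale UNIV)) UNIV = {0}"
begin

abbreviation J :: "'a set" where "J \<equiv> jacobson_radical scale UNIV"

lemma J_iff: "x \<in> J \<longleftrightarrow> (\<forall>a b. a * x * b = 0)"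
proof
  assume x: "x \<in> J"
  have one: "y * z \<in> set_mult Y Z" if "y \<in> Y" "z \<in> Z" for y z :: 'a and Y Z
    unfolding set_mult_def using that
    by (intro CollectI exI[of _ "Suc 0"] exI[of _ "\<lambda>_. y"] exI[of _ "\<lambda>_. z"]) auto
  have "a * x * b \<in> set_mult (set_mult UNIV J) UNIV" for a b
    by (intro one x UNIV_I)
  then show "\<forall>a b. a * x * b = 0" using annihilated by auto
next
  assume x: "\<forall>a b. a * x * b = 0"
  have "left_ideal scale UNIV {x. \<forall>a b. a * x * b = 0}"
    unfolding left_ideal_def
    by (auto intro!: subspaceI simp: distrib_left distrib_right scale_mult_left scale_mult_right
        mult.assoc[symmetric])
  then have "{x. \<forall>a b. a * x * b = 0} \<subseteq> J"
    by (rule left_ideal_subset_jacobson_radical[OF subalgebra_UNIV]) simp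
  then show "x \<in> J" using x by blast
qed

lemma J_annihilates: "x \<in> J \<Longrightarrow> a * x * b = 0"
  by (simp add: J_iff)

lemma subspace_J: "subspace J"
  by (auto intro!: subspaceI simp: J_iff distrib_left distrib_right scale_mult_left scale_mult_right)

lemma J_mult: "x \<in> J \<Longrightarrow> a * x \<in> J" "x \<in> J \<Longrightarrow> x * a \<in> J"
  by (simp_all add: J_iff mult.assoc)

lemma J_add: "x \<in> J \<Longrightarrow> y \<in> J \<Longrightarrow> x + y \<in> J"
  and J_diff: "x \<in> J \<Longrightarrow> y \<in> J \<Longrightarrow> x - y \<in> J"
  by (simp_all add: subspace_add subspace_diff subspace_J)

lemma left_ideal_subset_J:
  assumes "subspace K" "\<And>a x. x \<in> K \<Longrightarrow> a * x \<in> K" "\<And>x y. x \<in> K \<Longrightarrow> y \<in> K \<Longrightarrow> x * y \<in> J"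
  shows "K \<subseteq> J"
proof (rule left_ideal_subset_jacobson_radical[OF subalgebra_UNIV])
  show "left_ideal scale UNIV K" using assms by (simp add: left_ideal_def)
  show "x * x * x * x = 0" if "x \<in> K" for x
    using J_annihilates[OF assms(3)[OF that that]] by (simp add: mult.assoc)
qed

lemma right_ideal_subset_J:
  assumes K: "subspace K" "\<And>a x. x \<in> K \<Longrightarrow> x * a \<in> K" "\<And>x y. x \<in> K \<Longrightarrow> y \<in> K \<Longrightarrow> x * y \<in> J"
  shows "K \<subseteq> J"
proof
  fix x assume x: "x \<in> K"
  let ?T = "{c *s x + a * x | c a. True}"
  have "?T \<subseteq> J"
  proof (rule left_ideal_subset_J)
    show "subspace ?T"
    proof (rule subspaceI)
      show "0 \<in> ?T" by (force intro: exI[of _ 0])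
    next
      fix y z assume "y \<in> ?T" "z \<in> ?T"
      then obtain c a d b where "y = c *s x + a * x" "z = d *s x + b * x" by blast
      then have "y + z = (c + d) *s x + (a + b) * x"
        by (simp add: scale_left_distrib distrib_right)
      then show "y + z \<in> ?T" by blast
    next
      fix c y assume "y \<in> ?T"
      then obtain d b where "y = d *s x + b * x" by blast
      then have "c *s y = (c * d) *s x + (c *s b) * x"
        by (simp add: scale_right_distrib scale_mult_left)
      then show "c *s y \<in> ?T" by blast
    qed
  next
    fix b y assume "y \<in> ?T"
    then obtain c a where "y = c *s x + a * x" by blast
    then have "b * y = 0 *s x + (c *s b + b * a) * x"
      by (simp add: distrib_left distrib_right scale_mult_left scale_mult_right mult.assoc)
    then show "b * y \<in> ?T" by blast
  next
    fix y z assume "y \<in> ?T" "z \<in> ?T"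
    then obtain c a d b where yz: "y = c *s x + a * x" "z = d *s x + b * x" by blast
    have "x * z = d *s (x * x) + x * b * x"
      by (simp add: yz distrib_left scale_mult_right mult.assoc)
    then have "x * z \<in> J"
      using K(3) x K(2) J_add subspace_scale[OF subspace_J] by auto
    moreover have "y * z = c *s (x * z) + a * (x * z)"
      by (simp add: yz(1) distrib_right scale_mult_left mult.assoc)
    ultimately show "y * z \<in> J"
      using J_add J_mult subspace_scale[OF subspace_J] by auto
  qed
  moreover have "x \<in> ?T" by (force intro: exI[of _ 1] exI[of _ 0])
  ultimately show "x \<in> J" by blast
qed

lemma semiprime_modulo_left: "semiprime_modulo scale Basis (*) J"
  by unfold_locales
    (auto simp: distrib_left distrib_right scale_mult_left scale_mult_right mult.assoc
      subspace_J J_mult intro: subsetD[OF left_ideal_subset_J])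

lemma semiprime_modulo_right: "semiprime_modulo scale Basis (\<lambda>x y. y * x) J"
  by unfold_locales
    (auto simp: distrib_left distrib_right scale_mult_left scale_mult_right mult.assoc
      subspace_J J_mult intro: subsetD[OF right_ideal_subset_J])

lemma semisimple_complement:
  assumes B: "subalgebra scale B" and sum: "is_direct_sum2 scale UNIV B J"
  shows "semisimple_subalgebra scale B"
proof -
  have sB: "subspace B" and Bm: "\<And>x y. x \<in> B \<Longrightarrow> y \<in> B \<Longrightarrow> x * y \<in> B"
    using B by (auto simp: subalgebra_def)
  have BJ: "B \<inter> J = {0}" and dec: "\<exists>b r. x = b + r \<and> b \<in> B \<and> r \<in> J" for x
    using sum is_direct_sum2E[OF sum UNIV_I[of x]] by (simp add: is_direct_sum2_def, metis)
  have restrict: "modular_maximal_left_ideal scale B (M \<inter> B)"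
    if M: "modular_maximal_left_ideal scale UNIV M" for M
  proof -
    have sM: "subspace M" and Mm: "\<And>a x. x \<in> M \<Longrightarrow> a * x \<in> M" and "M \<noteq> UNIV"
      and max: "\<And>K. left_ideal scale UNIV K \<Longrightarrow> M \<subseteq> K \<Longrightarrow> K = M \<or> K = UNIV"
      using M by (auto simp: modular_maximal_left_ideal_def left_ideal_def)
    obtain u where u: "\<And>x. x - x * u \<in> M"
      using M by (auto simp: modular_maximal_left_ideal_def)
    have JM: "J \<subseteq> M" using M by (auto simp: jacobson_radical_def)
    have "M \<inter> B \<noteq> B"
    proof
      assume "M \<inter> B = B"
      then have "x \<in> M" for x
        using dec[of x] JM subspace_add[OF sM] by auto
      then show False using \<open>M \<noteq> UNIV\<close> by blast
    qed
    moreover have "left_ideal scale B (M \<inter> B)"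
      using sM sB Mm Bm by (auto simp: left_ideal_def subspace_inter)
    moreover have "K = M \<inter> B \<or> K = B" if K: "left_ideal scale B K" "M \<inter> B \<subseteq> K" for K
    proof -
      have sK: "subspace K" and KB: "K \<subseteq> B" and Km: "\<And>a x. a \<in> B \<Longrightarrow> x \<in> K \<Longrightarrow> a * x \<in> K"
        using K by (auto simp: left_ideal_def)
      let ?T = "{x + y | x y. x \<in> K \<and> y \<in> J}"
      have "left_ideal scale UNIV ?T"
        unfolding left_ideal_def
      proof (intro conjI ballI subset_UNIV)
        show "subspace ?T" by (intro subspace_sums sK subspace_J)
        fix a z assume "z \<in> ?T"
        then obtain x y where xy: "z = x + y" "x \<in> K" "y \<in> J" by blast
        obtain b r where br: "a = b + r" "b \<in> B" "r \<in> J" using dec by blast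
        have "a * z = b * x + (r * x + a * y)" by (simp add: xy br(1) algebra_simps)
        moreover have "r * x + a * y \<in> J" using br xy J_add J_mult by blast
        ultimately show "a * z \<in> ?T" using Km[OF br(2) xy(2)] by blast
      qed
      moreover have "M \<subseteq> ?T"
      proof
        fix x assume x: "x \<in> M"
        obtain b r where br: "x = b + r" "b \<in> B" "r \<in> J" using dec by blast
        have "x - r \<in> M" using x br(3) JM by (intro subspace_diff[OF sM]) auto
        then have "b \<in> M" by (simp add: br(1))
        then show "x \<in> ?T" using br K(2) by blast
      qed
      ultimately consider "?T = M" | "?T = UNIV" using max by blast
      then show ?thesis
      proof cases
        case 1
        then have "K \<subseteq> M" using subspace_0[OF subspace_J] by force
        then show ?thesis using KB K(2) by blast
      next
        case 2
        have "b \<in> K" if b: "b \<in> B" for b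
        proof -
          obtain k r where kr: "b = k + r" "k \<in> K" "r \<in> J" using 2 by blast
          have "b - k \<in> B" using b kr(2) KB by (intro subspace_diff[OF sB]) auto
          then have "r \<in> B" by (simp add: kr(1))
          then have "r = 0" using BJ kr by blast
          then show ?thesis using kr by simp
        qed
        then show ?thesis using KB by blast
      qed
    qed
    moreover have "\<exists>u\<in>B. \<forall>x\<in>B. x - x * u \<in> M \<inter> B"
    proof -
      obtain b r where br: "u = b + r" "b \<in> B" "r \<in> J" using dec by blast
      have "x - x * b \<in> M" for x
      proof -
        have "(x - x * u) + x * r \<in> M"
          using JM J_mult(1)[OF br(3)] by (intro subspace_add[OF sM] u) auto
        then show ?thesis by (simp add: br(1) algebra_simps)
      qed
      then show ?thesis using br(2) Bm subspace_diff[OF sB] by blast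
    qed
    ultimately show ?thesis by (simp add: modular_maximal_left_ideal_def)
  qed
  have "jacobson_radical scale B \<subseteq> B \<inter> J"
    using restrict by (auto simp: jacobson_radical_def)
  moreover have "0 \<in> jacobson_radical scale B"
    using subspace_0[OF sB] subspace_0
    by (auto simp: jacobson_radical_def modular_maximal_left_ideal_def left_ideal_def)
  ultimately show ?thesis using B BJ by (auto simp: semisimple_subalgebra_def)
qed

lemma maximal_semisimple_complement:
  assumes B: "subalgebra scale B" and sum: "is_direct_sum2 scale UNIV B J"
  shows "maximal_semisimple_subalgebra scale B"
  unfolding maximal_semisimple_subalgebra_def
proof (intro conjI allI impI semisimple_complement[OF assms])
  fix C assume C: "semisimple_subalgebra scale C \<and> B \<subseteq> C"
  then have CA: "subalgebra scale C" and sC: "subspace C" and Cm: "\<And>x y. x \<in> C \<Longrightarrow> y \<in> C \<Longrightarrow> x * y \<in> C"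
    by (auto simp: semisimple_subalgebra_def subalgebra_def)
  have "left_ideal scale C (C \<inter> J)"
    using sC Cm J_mult by (auto simp: left_ideal_def subspace_inter subspace_J)
  then have "C \<inter> J \<subseteq> jacobson_radical scale C"
    by (rule left_ideal_subset_jacobson_radical[OF CA]) (auto simp: J_annihilates)
  then have CJ: "C \<inter> J \<subseteq> {0}" using C by (simp add: semisimple_subalgebra_def)
  have "x \<in> B" if x: "x \<in> C" for x
  proof -
    obtain b r where br: "x = b + r" "b \<in> B" "r \<in> J"
      using is_direct_sum2E[OF sum UNIV_I] by blast
    have "x - b \<in> C" using x br(2) C by (intro subspace_diff[OF sC]) auto
    then have "r \<in> C" by (simp add: br(1))
    then have "r = 0" using CJ br by blast
    then show ?thesis using br by simp
  qed
  then show "C = B" using C by blast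
qed

end

text \<open>The map \<open>\<phi>\<close> below plays the role of the section of \<open>A \<rightarrow> A / J\<close> in Wedderburn's principal
  theorem, whose separability hypothesis is not available here.\<close>

locale radical_splitting = annihilated_radical scale Basis
  for scale :: "'f::field \<Rightarrow> 'a::ring \<Rightarrow> 'a" (infixr "*s" 75) and Basis :: "'a set" +
  fixes u u' :: 'a
  assumes u: "x - x * u \<in> J" "x - u * x \<in> J"
    and u': "x - x * u' \<in> J" "x - u' * x \<in> J"
begin

definition \<phi> :: "'a \<Rightarrow> 'a" where "\<phi> x = u' * x * u"

lemma \<phi>_cong: "x - y \<in> J \<Longrightarrow> \<phi> x = \<phi> y"
  using J_annihilates[of "x - y" u' u] by (simp add: \<phi>_def algebra_simps)

lemma \<phi>_add: "\<phi> (x + y) = \<phi> x + \<phi> y"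
  by (simp add: \<phi>_def algebra_simps)

lemma \<phi>_scale: "\<phi> (c *s x) = c *s \<phi> x"
  by (simp add: \<phi>_def scale_mult_left scale_mult_right)

lemma \<phi>_zero [simp]: "\<phi> 0 = 0"
  by (simp add: \<phi>_def)

lemma \<phi>_sum: "\<phi> (\<Sum>i\<in>I. g i) = (\<Sum>i\<in>I. \<phi> (g i))"
  by (simp add: \<phi>_def sum_distrib_left sum_distrib_right)

lemma \<phi>_mod: "x - \<phi> x \<in> J"
  using J_add[OF u'(2)[of x] u(1)[of "u' * x"]] by (simp add: \<phi>_def)

lemma \<phi>_mult: "\<phi> x * \<phi> y = \<phi> (x * y)"
proof -
  have "x * y - x * u * u' * y = (x - x * u) * y + (x * u - x * u * u') * y"
    by (simp add: algebra_simps)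
  then have "x * y - x * u * u' * y \<in> J"
    using u u' J_mult J_add by simp
  from \<phi>_cong[OF this] show ?thesis by (simp add: \<phi>_def mult.assoc)
qed

lemma \<phi>_\<phi>: "\<phi> (\<phi> x) = \<phi> x"
  using \<phi>_cong[OF \<phi>_mod] by simp

lemma subalgebra_range_\<phi>: "subalgebra scale (range \<phi>)"
  unfolding subalgebra_def
proof (intro conjI ballI subspaceI)
  show "0 \<in> range \<phi>" by (metis \<phi>_zero rangeI)
  fix x y assume xy: "x \<in> range \<phi>" "y \<in> range \<phi>"
  then show "x + y \<in> range \<phi>" by (auto simp flip: \<phi>_add)
  show "x * y \<in> range \<phi>" using xy by (auto simp: \<phi>_mult)
next
  fix c x assume "x \<in> range \<phi>"
  then show "c *s x \<in> range \<phi>"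
    by (auto simp flip: \<phi>_scale)
qed

lemma is_direct_sum2_range_\<phi>: "is_direct_sum2 scale UNIV (range \<phi>) J"
proof -
  have "range \<phi> \<inter> J = {0}"
  proof -
    have "x = 0" if "x \<in> range \<phi>" "x \<in> J" for x
      using that \<phi>_\<phi> \<phi>_cong[of x 0] by auto
    moreover have "0 \<in> range \<phi>" by (metis \<phi>_zero rangeI)
    ultimately show ?thesis using subspace_0[OF subspace_J] by blast
  qed
  moreover have "x \<in> {x + y | x y. x \<in> range \<phi> \<and> y \<in> J}" for x
    using \<phi>_mod[of x] by (intro CollectI exI[of _ "\<phi> x"] exI[of _ "x - \<phi> x"]) simp
  ultimately show ?thesis
    using subalgebra_range_\<phi> subspace_J by (auto simp: is_direct_sum2_def subalgebra_def)
qed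

lemma orthogonal_idempotents_\<phi>:
  assumes "\<And>i k. i \<in> I \<Longrightarrow> k \<in> I \<Longrightarrow> g i * g k - (if i = k then g i else 0) \<in> J"
  shows "orthogonal_idempotents I (\<lambda>i. \<phi> (g i))"
  using \<phi>_cong[OF assms] by (simp add: orthogonal_idempotents_def \<phi>_mult)

lemma is_identity_of_range_\<phi>:
  assumes "\<And>x. x - x * w \<in> J" "\<And>x. x - w * x \<in> J"
  shows "is_identity_of (range \<phi>) (\<phi> w)"
  using \<phi>_cong[OF assms(1)] \<phi>_cong[OF assms(2)] by (auto simp: is_identity_of_def \<phi>_mult)

lemma \<phi>_sandwich: "\<phi> x * a * \<phi> y = \<phi> (x * a * y)"
proof -
  have "\<phi> x * a * \<phi> y = \<phi> x * \<phi> a * \<phi> y"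
    using J_annihilates[OF \<phi>_mod[of a], of "\<phi> x" "\<phi> y"] by (simp add: algebra_simps)
  then show ?thesis by (simp add: \<phi>_mult)
qed

end

locale rees_graded_algebra = annihilated_radical scale Basis
  for scale :: "'f::field \<Rightarrow> 'a::ring \<Rightarrow> 'a" (infixr "*s" 75) and Basis :: "'a set" +
  fixes n m :: nat and P :: "nat \<Rightarrow> nat \<Rightarrow> triv0" and G :: "rees \<Rightarrow> 'a set"
  assumes grading: "semigroup_grading scale (rees_carrier n m) (rees_mult P) G"
    and G_Theta: "G Theta = {0}"
begin

abbreviation A where "A \<equiv> A_comp G"

lemma direct_sum_G: "is_direct_sum scale UNIV (rees_carrier n m) G"
  using grading by (simp add: semigroup_grading_def)

lemma Elt_carrier: "Elt i j \<in> rees_carrier n m \<longleftrightarrow> i \<in> {1..n} \<and> j \<in> {1..m}"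
  by (auto simp: rees_carrier_def)

lemma subspace_A: "i \<in> {1..n} \<Longrightarrow> j \<in> {1..m} \<Longrightarrow> subspace (A i j)"
  using direct_sum_G Elt_carrier by (auto simp: is_direct_sum_def A_comp_def)

lemma A_mult:
  assumes "i \<in> {1..n}" "j \<in> {1..m}" "k \<in> {1..n}" "l \<in> {1..m}" "x \<in> A i j" "y \<in> A k l"
  shows "x * y \<in> A i l"
proof -
  have "Elt i j \<in> rees_carrier n m" "Elt k l \<in> rees_carrier n m"
    using assms by (simp_all add: Elt_carrier)
  then have "x * y \<in> G (rees_mult P (Elt i j) (Elt k l))"
    using grading assms(5,6) unfolding semigroup_grading_def A_comp_def by blast
  then show ?thesis
    using subspace_0[OF subspace_A] assms G_Theta by (auto simp: A_comp_def split: if_splits)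
qed

lemma A_spans:
  assumes V: "subspace V" "\<And>i j. i \<in> {1..n} \<Longrightarrow> j \<in> {1..m} \<Longrightarrow> A i j \<subseteq> V"
  shows "x \<in> V"
proof -
  have "x \<in> (\<lambda>v. \<Sum>s\<in>rees_carrier n m. v s) ` PiE (rees_carrier n m) G"
    using direct_sum_G by (simp add: is_direct_sum_def bij_betw_def)
  then obtain v where v: "v \<in> PiE (rees_carrier n m) G" "x = (\<Sum>s\<in>rees_carrier n m. v s)"
    by blast
  have "v s \<in> V" if s: "s \<in> rees_carrier n m" for s
  proof (cases s)
    case (Elt i j)
    then show ?thesis using PiE_mem[OF v(1) s] V(2)[of i j] s by (auto simp: Elt_carrier A_comp_def)
  next
    case Theta
    then show ?thesis using PiE_mem[OF v(1) s] G_Theta subspace_0[OF V(1)] by simp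
  qed
  then show ?thesis unfolding v(2) by (intro subspace_sum[OF V(1)])
qed

lemma sum_rees_carrier:
  "(\<Sum>s\<in>rees_carrier n m. g s) = g Theta + (\<Sum>(i, j)\<in>{1..n} \<times> {1..m}. g (Elt i j))"
proof -
  have "rees_carrier n m = insert Theta ((\<lambda>(i, j). Elt i j) ` ({1..n} \<times> {1..m}))"
    by (force simp: rees_carrier_def)
  moreover have "inj_on (\<lambda>(i, j). Elt i j) ({1..n} \<times> {1..m})"
    by (auto intro: inj_onI)
  ultimately show ?thesis
    by (subst sum.insert[symmetric] | simp add: sum.reindex case_prod_unfold comp_def image_iff)+
qed

lemma A_independent:
  assumes v: "\<And>i j. i \<in> {1..n} \<Longrightarrow> j \<in> {1..m} \<Longrightarrow> v i j \<in> A i j"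
    and sum: "(\<Sum>(i, j)\<in>{1..n} \<times> {1..m}. v i j) = 0"
    and ij: "i \<in> {1..n}" "j \<in> {1..m}"
  shows "v i j = 0"
proof -
  let ?S = "rees_carrier n m"
  let ?v = "restrict (case_rees v 0) ?S" and ?z = "restrict (\<lambda>_. 0) ?S"
  have "?v \<in> PiE ?S G"
    using v G_Theta by (auto simp: Elt_carrier A_comp_def split: rees.splits)
  moreover have "?z \<in> PiE ?S G"
    using direct_sum_G subspace_0 by (auto simp: is_direct_sum_def)
  moreover have "(\<Sum>s\<in>?S. ?v s) = (\<Sum>s\<in>?S. ?z s)"
    using sum sum_rees_carrier[of "case_rees v 0"] by simp
  moreover have "inj_on (\<lambda>v. \<Sum>s\<in>?S. v s) (PiE ?S G)"
    using direct_sum_G by (simp add: is_direct_sum_def bij_betw_def)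
  ultimately have "?v = ?z" by (blast intro: inj_onD)
  then have "?v (Elt i j) = ?z (Elt i j)" by simp
  then show ?thesis using ij Elt_carrier by simp
qed

abbreviation L where "L \<equiv> L_comp n G"
abbreviation R where "R \<equiv> R_comp m G"

lemma subspace_L: "j \<in> {1..m} \<Longrightarrow> subspace (L j)"
  unfolding L_comp_def by (intro subspace_family_sum subspace_A)

lemma subspace_R: "i \<in> {1..n} \<Longrightarrow> subspace (R i)"
  unfolding R_comp_def by (intro subspace_family_sum subspace_A)

lemma A_subset_L: "i \<in> {1..n} \<Longrightarrow> j \<in> {1..m} \<Longrightarrow> A i j \<subseteq> L j"
  unfolding L_comp_def by (intro subsetI family_sum_mem subspace_A) auto

lemma A_subset_R: "i \<in> {1..n} \<Longrightarrow> j \<in> {1..m} \<Longrightarrow> A i j \<subseteq> R i"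
  unfolding R_comp_def by (intro subsetI family_sum_mem subspace_A) auto

lemma subspace_left_transporter: "subspace V \<Longrightarrow> subspace {a. a * x \<in> V}"
  by (auto intro!: subspaceI simp: distrib_right scale_mult_left subspace_0 subspace_add subspace_scale)

lemma subspace_right_transporter: "subspace V \<Longrightarrow> subspace {a. x * a \<in> V}"
  by (auto intro!: subspaceI simp: distrib_left scale_mult_right subspace_0 subspace_add subspace_scale)

lemma L_left_ideal:
  assumes j: "j \<in> {1..m}" and x: "x \<in> L j"
  shows "a * x \<in> L j"
proof -
  obtain b where b: "x = (\<Sum>k=1..n. b k)" "\<And>k. k \<in> {1..n} \<Longrightarrow> b k \<in> A k j"
    using x by (auto simp: L_comp_def)
  have "a \<in> {a. a * b k \<in> L j}" if k: "k \<in> {1..n}" for k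
  proof (rule A_spans[OF subspace_left_transporter[OF subspace_L[OF j]]])
    fix i l assume il: "i \<in> {1..n}" "l \<in> {1..m}"
    show "A i l \<subseteq> {a. a * b k \<in> L j}"
      using A_mult[OF il k j _ b(2)[OF k]] A_subset_L[OF il(1) j] by blast
  qed
  then show ?thesis
    by (auto simp: b(1) sum_distrib_left intro!: subspace_sum subspace_L j)
qed

lemma R_right_ideal:
  assumes i: "i \<in> {1..n}" and x: "x \<in> R i"
  shows "x * a \<in> R i"
proof -
  obtain b where b: "x = (\<Sum>k=1..m. b k)" "\<And>k. k \<in> {1..m} \<Longrightarrow> b k \<in> A i k"
    using x by (auto simp: R_comp_def)
  have "a \<in> {a. b k * a \<in> R i}" if k: "k \<in> {1..m}" for k
  proof (rule A_spans[OF subspace_right_transporter[OF subspace_R[OF i]]])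
    fix h l assume hl: "h \<in> {1..n}" "l \<in> {1..m}"
    show "A h l \<subseteq> {a. b k * a \<in> R i}"
      using A_mult[OF i k hl b(2)[OF k]] A_subset_R[OF i hl(2)] by blast
  qed
  then show ?thesis
    by (auto simp: b(1) sum_distrib_right intro!: subspace_sum subspace_R i)
qed

lemma R_mult_L:
  assumes ij: "i \<in> {1..n}" "j \<in> {1..m}" and xy: "x \<in> R i" "y \<in> L j"
  shows "x * y \<in> A i j"
proof -
  obtain b where b: "x = (\<Sum>k=1..m. b k)" "\<And>k. k \<in> {1..m} \<Longrightarrow> b k \<in> A i k"
    using xy by (auto simp: R_comp_def)
  obtain c where c: "y = (\<Sum>l=1..n. c l)" "\<And>l. l \<in> {1..n} \<Longrightarrow> c l \<in> A l j"
    using xy by (auto simp: L_comp_def)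
  have "b k * c l \<in> A i j" if kl: "k \<in> {1..m}" "l \<in> {1..n}" for k l
    by (rule A_mult[OF ij(1) kl ij(2) b(2)[OF kl(1)] c(2)[OF kl(2)]])
  then show ?thesis
    unfolding b(1) c(1) sum_product by (intro subspace_sum subspace_A ij)
qed

lemma ex_left_idempotents:
  obtains g where "\<And>j. j \<in> {1..m} \<Longrightarrow> g j \<in> L j"
    and "\<And>j k. j \<in> {1..m} \<Longrightarrow> k \<in> {1..m} \<Longrightarrow> g j * g k - (if j = k then g j else 0) \<in> J"
    and "\<And>x. x - x * (\<Sum>j=1..m. g j) \<in> J"
proof -
  interpret l: semiprime_modulo scale Basis "(*)" J by (rule semiprime_modulo_left)
  obtain g where g: "\<forall>j\<in>{1..m}. g j \<in> L j"
    "\<forall>j\<in>{1..m}. \<forall>k\<in>{1..m}. l.eqv (g j * g k) (if j = k then g j else 0)"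
    "\<forall>j\<in>{1..m}. \<forall>x\<in>L j. l.eqv x (x * (\<Sum>k=1..m. g k))"
    using l.ex_orthogonal_idempotents_mod[of "{1..m}" L] subspace_L L_left_ideal
    unfolding l.is_lideal_def by auto
  have "x \<in> {x. l.eqv x (x * (\<Sum>k=1..m. g k))}" for x
    using l.is_lidealD(1)[OF l.is_lideal_fixed] g(3) A_subset_L by (intro A_spans) blast+
  with g that show ?thesis unfolding l.eqv_def by blast
qed

lemma ex_right_idempotents:
  obtains g where "\<And>i. i \<in> {1..n} \<Longrightarrow> g i \<in> R i"
    and "\<And>i k. i \<in> {1..n} \<Longrightarrow> k \<in> {1..n} \<Longrightarrow> g i * g k - (if i = k then g i else 0) \<in> J"
    and "\<And>x. x - (\<Sum>i=1..n. g i) * x \<in> J"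
proof -
  interpret r: semiprime_modulo scale Basis "\<lambda>x y. y * x" J by (rule semiprime_modulo_right)
  obtain g where g: "\<forall>i\<in>{1..n}. g i \<in> R i"
    "\<forall>i\<in>{1..n}. \<forall>k\<in>{1..n}. r.eqv (g k * g i) (if i = k then g i else 0)"
    "\<forall>i\<in>{1..n}. \<forall>x\<in>R i. r.eqv x ((\<Sum>k=1..n. g k) * x)"
    using r.ex_orthogonal_idempotents_mod[of "{1..n}" R] subspace_R R_right_ideal
    unfolding r.is_lideal_def by auto
  have "x \<in> {x. r.eqv x ((\<Sum>k=1..n. g k) * x)}" for x
    using r.is_lidealD(1)[OF r.is_lideal_fixed] g(3) A_subset_R by (intro A_spans) blast+
  moreover have "g i * g k - (if i = k then g i else 0) \<in> J"
    if "i \<in> {1..n}" "k \<in> {1..n}" for i k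
    using g(2)[rule_format, OF that(2,1)] unfolding r.eqv_def by (cases "i = k") simp_all
  ultimately show ?thesis using g(1) that unfolding r.eqv_def by blast
qed

theorem graded_splitting:
  "\<exists>f f' B.
      orthogonal_idempotents {1..m} f \<and>
      orthogonal_idempotents {1..n} f' \<and>
      is_direct_sum scale B ({1..n} \<times> {1..m}) (\<lambda>(i, j). {f' i * a * f j | a. a \<in> UNIV}) \<and>
      graded_subspace scale n m G B \<and>
      maximal_semisimple_subalgebra scale B \<and>
      (\<forall>i\<in>{1..n}. f' i \<in> B \<inter> R i) \<and>
      (\<forall>j\<in>{1..m}. f j \<in> B \<inter> L j) \<and>
      (\<Sum>i=1..n. f' i) = (\<Sum>j=1..m. f j) \<and>
      is_identity_of B (\<Sum>j=1..m. f j) \<and>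
      is_direct_sum2 scale UNIV B J"
proof -
  obtain g where gL: "\<And>j. j \<in> {1..m} \<Longrightarrow> g j \<in> L j"
    and g_orth: "\<And>j k. j \<in> {1..m} \<Longrightarrow> k \<in> {1..m} \<Longrightarrow> g j * g k - (if j = k then g j else 0) \<in> J"
    and g_unit: "\<And>x. x - x * (\<Sum>j=1..m. g j) \<in> J"
    using ex_left_idempotents by blast
  obtain g' where gR: "\<And>i. i \<in> {1..n} \<Longrightarrow> g' i \<in> R i"
    and g'_orth: "\<And>i k. i \<in> {1..n} \<Longrightarrow> k \<in> {1..n} \<Longrightarrow> g' i * g' k - (if i = k then g' i else 0) \<in> J"
    and g'_unit: "\<And>x. x - (\<Sum>i=1..n. g' i) * x \<in> J"
    using ex_right_idempotents by blast
  define r where "r = (\<Sum>j=1..m. g j)"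
  define l where "l = (\<Sum>i=1..n. g' i)"
  text \<open>Squaring the summands gives \<open>g' k * g' k * g' i * u = 0\<close> for \<open>k \<noteq> i\<close>: the factor
    \<open>g' k * g' i\<close>, which lies in \<open>J\<close>, now has neighbours on both sides.\<close>
  define u where "u = (\<Sum>j=1..m. g j * g j)"
  define u' where "u' = (\<Sum>i=1..n. g' i * g' i)"
  have ur: "u - r \<in> J"
    using g_orth[of j j for j] unfolding u_def r_def sum_subtractf[symmetric]
    by (intro subspace_sum[OF subspace_J]) simp
  have u'l: "u' - l \<in> J"
    using g'_orth[of i i for i] unfolding u'_def l_def sum_subtractf[symmetric]
    by (intro subspace_sum[OF subspace_J]) simp
  have lr: "l - r \<in> J"
    using J_diff[OF g_unit[of l] g'_unit[of r]] by (simp add: l_def r_def)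
  have unit: "x - x * w \<in> J" "x - w * x \<in> J" if w: "w - r \<in> J" for x w
  proof -
    have "(x - x * r) - x * (w - r) \<in> J"
      using J_diff[OF g_unit[of x] J_mult(1)[OF w]] by (simp add: r_def)
    then show "x - x * w \<in> J" by (simp add: algebra_simps)
    have "(x - l * x) + (l - r) * x - (w - r) * x \<in> J"
      using J_diff[OF J_add[OF g'_unit[of x] J_mult(2)[OF lr]] J_mult(2)[OF w]]
      by (simp add: l_def)
    then show "x - w * x \<in> J" by (simp add: algebra_simps)
  qed
  have u'r: "u' - r \<in> J" using J_add[OF u'l lr] by simp
  interpret radical_splitting scale Basis u u'
    by unfold_locales (intro unit ur u'r)+
  define f where "f j = \<phi> (g j)" for j
  define f' where "f' i = \<phi> (g' i)" for i
  define B where "B = range \<phi>"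
  have sum_f: "(\<Sum>j=1..m. f j) = \<phi> r" by (simp add: f_def r_def \<phi>_sum)
  have sum_f': "(\<Sum>i=1..n. f' i) = \<phi> r"
    using \<phi>_cong[OF lr] by (simp add: f'_def l_def \<phi>_sum)
  have orth: "orthogonal_idempotents {1..m} f" "orthogonal_idempotents {1..n} f'"
    unfolding f_def f'_def by (intro orthogonal_idempotents_\<phi> g_orth g'_orth; assumption)+
  have id: "is_identity_of B (\<phi> r)"
    unfolding B_def by (intro is_identity_of_range_\<phi> unit) (simp_all add: subspace_0[OF subspace_J])
  have fL: "f j \<in> L j" if j: "j \<in> {1..m}" for j
  proof -
    have "u' * g j * (g k * g k) \<in> L j" if k: "k \<in> {1..m}" for k
    proof (cases "k = j")
      case True
      then show ?thesis by (simp add: mult.assoc[symmetric] L_left_ideal[OF j gL[OF j]])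
    next
      case False
      then have "u' * (g j * g k) * g k = 0"
        using g_orth[OF j k] by (intro J_annihilates) simp
      then show ?thesis using subspace_0[OF subspace_L[OF j]] by (simp add: mult.assoc)
    qed
    then show ?thesis
      unfolding f_def \<phi>_def unfolding u_def sum_distrib_left by (intro subspace_sum subspace_L j)
  qed
  have fR: "f' i \<in> R i" if i: "i \<in> {1..n}" for i
  proof -
    have "(g' k * g' k) * g' i * u \<in> R i" if k: "k \<in> {1..n}" for k
    proof (cases "k = i")
      case True
      then show ?thesis by (simp add: mult.assoc R_right_ideal[OF i gR[OF i]])
    next
      case False
      then have "g' k * (g' k * g' i) * u = 0"
        using g'_orth[OF k i] by (intro J_annihilates) simp
      then show ?thesis using subspace_0[OF subspace_R[OF i]] by (simp add: mult.assoc)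
    qed
    then show ?thesis
      unfolding f'_def \<phi>_def unfolding u'_def sum_distrib_right by (intro subspace_sum subspace_R i)
  qed
  have fAf: "f' i * a * f j \<in> B" for i j a
    by (simp add: f_def f'_def B_def \<phi>_sandwich)
  have unit_B: "(\<Sum>i=1..n. f' i) * b * (\<Sum>j=1..m. f j) = b" if "b \<in> B" for b
    using id that unfolding sum_f sum_f' by (simp add: is_identity_of_def)
  have sB: "subspace B"
    using subalgebra_range_\<phi> by (simp add: B_def subalgebra_def)
  have sum: "is_direct_sum scale B ({1..n} \<times> {1..m}) (\<lambda>(i, j). {f' i * a * f j | a. a \<in> UNIV})"
    using fAf unit_B by (intro is_direct_sum_peirce orth sB) auto
  have fAf_A: "f' i * a * f j \<in> A i j" if "i \<in> {1..n}" "j \<in> {1..m}" for i j a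
    using that by (intro R_mult_L R_right_ideal fR fL)
  have comp: "B \<inter> A i j = {f' i * a * f j | a. a \<in> UNIV}" if ij: "i \<in> {1..n}" "j \<in> {1..m}" for i j
  proof (intro equalityI subsetI)
    fix b assume b: "b \<in> B \<inter> A i j"
    define v where "v k l = f' k * b * f l - (if k = i \<and> l = j then b else 0)" for k l
    have "b = (\<Sum>(k, l)\<in>{1..n} \<times> {1..m}. f' k * b * f l)"
      using unit_B[of b, symmetric] b
      by (simp only: sum_distrib_right[of _ _ b] sum_product sum.cartesian_product Int_iff)
    moreover have "(\<Sum>(k, l)\<in>{1..n} \<times> {1..m}. if k = i \<and> l = j then b else 0) = b"
    proof -
      have "(\<Sum>(k, l)\<in>{1..n} \<times> {1..m}. if k = i \<and> l = j then b else 0)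
          = (\<Sum>p\<in>{1..n} \<times> {1..m}. if p = (i, j) then b else 0)"
        by (intro sum.cong) (auto split: if_splits)
      then show ?thesis using ij by simp
    qed
    ultimately have "(\<Sum>(k, l)\<in>{1..n} \<times> {1..m}. v k l) = 0"
      by (simp add: v_def case_prod_unfold sum_subtractf)
    moreover have "v k l \<in> A k l" if "k \<in> {1..n}" "l \<in> {1..m}" for k l
      unfolding v_def using b that by (intro subspace_diff subspace_A fAf_A) (auto simp: subspace_0[OF subspace_A[OF that]])
    ultimately have "v i j = 0" using A_independent[of v] ij by blast
    then have "b = f' i * b * f j" by (simp add: v_def)
    then show "b \<in> {f' i * a * f j | a. a \<in> UNIV}" by blast
  qed (use fAf fAf_A ij in blast)
  have "is_direct_sum scale B ({1..n} \<times> {1..m}) (\<lambda>(i, j). B \<inter> A i j)"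
    by (rule iffD1[OF is_direct_sum_cong sum]) (clarify, simp only: prod.case comp)
  then have "graded_subspace scale n m G B"
    by (simp add: graded_subspace_def)
  moreover have "maximal_semisimple_subalgebra scale B"
    unfolding B_def by (intro maximal_semisimple_complement subalgebra_range_\<phi> is_direct_sum2_range_\<phi>)
  moreover have "f' i \<in> B" "f j \<in> B" for i j
    by (simp_all add: f_def f'_def B_def)
  moreover have "is_direct_sum2 scale UNIV B J"
    unfolding B_def by (rule is_direct_sum2_range_\<phi>)
  ultimately show ?thesis
    using orth sum fL fR id[folded sum_f] trans[OF sum_f' sum_f[symmetric]]
    by - (rule exI[of _ f], rule exI[of _ f'], rule exI[of _ B], simp)
qed

end

theorem theorem4p2:
  fixes scale :: "'f::field \<Rightarrow> 'a::ring \<Rightarrow> 'a"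
    and Basis :: "'a set"
    and n m :: nat
    and P :: "nat \<Rightarrow> nat \<Rightarrow> triv0"
    and G :: "rees \<Rightarrow> 'a set"
  assumes "fd_algebra scale Basis"
    and "n \<ge> 1" and "m \<ge> 1"
    and "rees_completely_0_simple n m P"
    and "semigroup_grading scale (rees_carrier n m) (rees_mult P) G"
    and "G Theta = {0}"
    and "rees_carrier n m =
      generated_subsemigroup (rees_mult P) (grading_support (rees_carrier n m) G) \<union> {Theta}"
    and "set_mult (set_mult UNIV (jacobson_radical scale UNIV)) UNIV = {0}"
  shows "\<exists>(f :: nat \<Rightarrow> 'a) (f' :: nat \<Rightarrow> 'a) (B :: 'a set).
      orthogonal_idempotents {1..m} f \<and>
      orthogonal_idempotents {1..n} f' \<and>
      is_direct_sum scale B ({1..n} \<times> {1..m}) (\<lambda>(i, j). {f' i * a * f j | a. a \<in> UNIV}) \<and>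
      graded_subspace scale n m G B \<and>
      maximal_semisimple_subalgebra scale B \<and>
      (\<forall>i\<in>{1..n}. f' i \<in> B \<inter> R_comp m G i) \<and>
      (\<forall>j\<in>{1..m}. f j \<in> B \<inter> L_comp n G j) \<and>
      (\<Sum>i=1..n. f' i) = (\<Sum>j=1..m. f j) \<and>
      is_identity_of B (\<Sum>j=1..m. f j) \<and>
      is_direct_sum2 scale UNIV B (jacobson_radical scale UNIV)"
proof -
  interpret fd_algebra scale Basis by fact
  interpret rees_graded_algebra scale Basis n m P G
    by unfold_locales fact+
  show ?thesis by (rule graded_splitting)
qed

end
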